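(* Assume that for every $g\in L^2(\Omega)$ the problem $-A:D^2 v=g$ in $\Omega$, $v=0$ on $\partial\Omega$, has a unique solution $v\in V$. Let $f\in L^2(\Omega)$, let $(u,\boldsymbol\sigma)\in H_0^1(\Omega)\times Q$ be the minimizer of $\mathcal{J}_0(\cdot,\cdot;f)$ over $H^1_0(\Omega)\times Q$ (so $-A:D^2u=f$ and $\boldsymbol\sigma=\nabla u$), and let $(u_h,\boldsymbol\sigma_h)\in S_{1,0}\times S_{1}^d$ be the minimizer of $\mathcal{J}_0(\cdot,\cdot;f)$ over $S_{1,0}\times S_{1}^d$ (the $L^2$-LSFEM solution). Define $$\eta_{0,K}^2=\|f+A:\nabla\boldsymbol\sigma_h\|_{0,K}^2+\|\boldsymbol\sigma_h-\nabla u_h\|_{0,K}^2\ (K\in\mathcal{T}),\qquad \eta_0^2=\sum_{K\in\mathcal{T}}\eta_{0,K}^2 .$$ Then $$\eta_0=|||(u-u_h,\boldsymbol\sigma-\boldsymbol\sigma_h)|||_0\quad\text{and}\quad \eta_{0,K}=|||(u-u_h,\boldsymbol\sigma-\boldsymbol\sigma_h)|||_{0,K}\quad\forall K\in\mathcal{T},$$ and there is a constant $C>0$ independent of the mesh size $h$ such that $$C\,\eta_{0,K}\le \|A:\nabla(\boldsymbol\sigma-\boldsymbol\sigma_h)\|_{0,K}+\|\boldsymbol\sigma-\boldsymbol\sigma_h\|_{0,K}+\|\nabla(u-u_h)\|_{0,K}\quad\forall K\in\mathcal{T}.$$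
   Context: Setting: $d\in\{2,3\}$, $\Omega\subset\mathbb{R}^d$ is a bounded open polytope, $A=(a_{ij})\in L^\infty(\Omega)^{d\times d}$ (possibly degenerate). $A:B=\sum_{i,j}a_{ij}b_{ij}$; $D^2v$ is the Hessian. $\|\cdot\|_{s,\omega}$ is the $H^s(\omega)$ norm, with $\omega$ omitted when $\omega=\Omega$. Spaces: $V=\{v\in H^1_0(\Omega): A:D^2v\in L^2(\Omega)\}$, $Q=\{\boldsymbol\tau\in L^2(\Omega)^d: A:\nabla\boldsymbol\tau\in L^2(\Omega)\}$. Convention: $A:\nabla\boldsymbol\tau=\sum_{i,j}a_{ij}\,\partial_j\tau_i$ is linear in $\boldsymbol\tau$, coincides with the a.e. expression for $\boldsymbol\tau\in H^1(\Omega)^d$, and $A:\nabla(\nabla v)=A:D^2v$. Mesh: $\mathcal{T}=\{K\}$ is a shape-regular simplicial triangulation of $\Omega$, $h_K=\operatorname{diam}K$, $h=\max_Kh_K$. $S_1=\{v\in H^1(\Omega): v|_K\in P_1(K)\ \forall K\in\mathcal{T}\}$, $S_{1,0}=S_1\cap H^1_0(\Omega)$. $$\mathcal{J}_0(v,\boldsymbol\tau;f)=\|f+A:\nabla\boldsymbol\tau\|_0^2+\|\boldsymbol\tau-\nabla v\|_0^2,$$ $$|||(v,\boldsymbol\tau)|||_{0,K}^2=\|A:\nabla\boldsymbol\tau\|_{0,K}^2+\|\boldsymbol\tau-\nabla v\|_{0,K}^2,\qquad |||(v,\boldsymbol\tau)|||_0^2=\|A:\nabla\boldsymbol\tau\|_{0}^2+\|\boldsymbol\tau-\nabla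 v\|_{0}^2 .$$ *)

theory Defs
  imports "HOL-Analysis.Analysis"
begin

text \<open>Elements of $L^2$ and of the Sobolev spaces are represented by functions on the whole of
  $R^d$. Only the values on the domain matter, and equality is equality almost everywhere there.\<close>

definition L2 :: "(real^'n) set \<Rightarrow> (real^'n \<Rightarrow> 'b::euclidean_space) set" where
  "L2 \<omega> = {g. g \<in> borel_measurable (lebesgue_on \<omega>) \<and>
               integrable (lebesgue_on \<omega>) (\<lambda>x. (norm (g x))\<^sup>2)}"

definition L2norm :: "(real^'n) set \<Rightarrow> (real^'n \<Rightarrow> 'b::euclidean_space) \<Rightarrow> real" where
  "L2norm \<omega> g = sqrt (\<integral>x. (norm (g x))\<^sup>2 \<partial>lebesgue_on \<omega>)"

definition Linf :: "(real^'n) set \<Rightarrow> (real^'n \<Rightarrow> 'b::euclidean_space) set" where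
  "Linf \<omega> = {g. g \<in> borel_measurable (lebesgue_on \<omega>) \<and>
                 (\<exists>M. AE x in lebesgue_on \<omega>. norm (g x) \<le> M)}"

definition partial_deriv :: "'n \<Rightarrow> (real^'n \<Rightarrow> real) \<Rightarrow> real^'n \<Rightarrow> real" where
  "partial_deriv i f x = frechet_derivative f (at x) (axis i 1)"

primrec Ck :: "nat \<Rightarrow> (real^'n \<Rightarrow> real) \<Rightarrow> bool" where
  "Ck 0 f = continuous_on UNIV f"
| "Ck (Suc k) f = (f differentiable_on UNIV \<and> (\<forall>i. Ck k (partial_deriv i f)))"

definition test_functions :: "(real^'n) set \<Rightarrow> (real^'n \<Rightarrow> real) set" where
  "test_functions \<Omega> = {\<phi>. (\<forall>k. Ck k \<phi>) \<and> compact (closure {x. \<phi> x \<noteq> 0}) \<and>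
                           closure {x. \<phi> x \<noteq> 0} \<subseteq> \<Omega>}"

definition is_weak_grad :: "(real^'n) set \<Rightarrow> (real^'n \<Rightarrow> real) \<Rightarrow> (real^'n \<Rightarrow> real^'n) \<Rightarrow> bool" where
  "is_weak_grad \<Omega> v g \<longleftrightarrow> g \<in> L2 \<Omega> \<and>
     (\<forall>\<phi>\<in>test_functions \<Omega>. \<forall>i.
        (\<integral>x. v x * partial_deriv i \<phi> x \<partial>lebesgue_on \<Omega>) = - (\<integral>x. g x $ i * \<phi> x \<partial>lebesgue_on \<Omega>))"

definition H1 :: "(real^'n) set \<Rightarrow> (real^'n \<Rightarrow> real) set" where
  "H1 \<Omega> = {v \<in> L2 \<Omega>. \<exists>g. is_weak_grad \<Omega> v g}"

text \<open>A representative of the weak gradient, which is unique up to null sets on an open set.\<close>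

definition weak_grad :: "(real^'n) set \<Rightarrow> (real^'n \<Rightarrow> real) \<Rightarrow> real^'n \<Rightarrow> real^'n" where
  "weak_grad \<Omega> v = (SOME g. is_weak_grad \<Omega> v g)"

definition H1norm :: "(real^'n) set \<Rightarrow> (real^'n \<Rightarrow> real) \<Rightarrow> real" where
  "H1norm \<Omega> v = sqrt ((L2norm \<Omega> v)\<^sup>2 + (L2norm \<Omega> (weak_grad \<Omega> v))\<^sup>2)"

definition H10 :: "(real^'n) set \<Rightarrow> (real^'n \<Rightarrow> real) set" where
  "H10 \<Omega> = {v \<in> H1 \<Omega>. \<exists>\<phi>. (\<forall>k::nat. \<phi> k \<in> test_functions \<Omega>) \<and>
                            (\<lambda>k. H1norm \<Omega> (\<lambda>x. v x - \<phi> k x)) \<longlonglongrightarrow> 0}"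

definition H1vec :: "(real^'n) set \<Rightarrow> (real^'n \<Rightarrow> real^'n) set" where
  "H1vec \<Omega> = {\<tau>. \<forall>i. (\<lambda>x. \<tau> x $ i) \<in> H1 \<Omega>}"

text \<open>Not necessarily convex. Taking the interior of the union excludes slits.\<close>

definition polytopal_domain :: "(real^'n) set \<Rightarrow> bool" where
  "polytopal_domain \<Omega> \<longleftrightarrow> \<Omega> \<noteq> {} \<and>
     (\<exists>P. finite P \<and> (\<forall>p\<in>P. polytope p) \<and> \<Omega> = interior (\<Union>P))"

text \<open>For a matrix field that is merely essentially bounded, the product of its entries with the
  distributions $\partial_j \tau_i$ has no canonical meaning for general square-integrable $\tau$. Hence
  $\tau \mapsto A:\nabla\tau$ is any map \<open>AG\<close>, with domain \<open>D\<close> (the fields for which it makes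
  sense as a function), that is linear, well defined on classes modulo null sets, and agrees with the
  almost-everywhere expression $\sum_{i,j} a_{ij} \partial_j \tau_i$ on $H^1$ fields.\<close>

definition nondiv_operator ::
  "(real^'n) set \<Rightarrow> (real^'n \<Rightarrow> real^'n^'n) \<Rightarrow> (real^'n \<Rightarrow> real^'n) set \<Rightarrow>
   ((real^'n \<Rightarrow> real^'n) \<Rightarrow> real^'n \<Rightarrow> real) \<Rightarrow> bool" where
  "nondiv_operator \<Omega> A D AG \<longleftrightarrow>
     (\<forall>\<tau>\<in>D. \<forall>\<rho>. (AE x in lebesgue_on \<Omega>. \<rho> x = \<tau> x) \<longrightarrow>
        \<rho> \<in> D \<and> (AE x in lebesgue_on \<Omega>. AG \<rho> x = AG \<tau> x)) \<and>
     (\<forall>\<tau>\<in>D. \<forall>\<rho>\<in>D. \<forall>a b. (\<lambda>x. a *\<^sub>R \<tau> x + b *\<^sub>R \<rho> x) \<in> D \<and>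
        (AE x in lebesgue_on \<Omega>. AG (\<lambda>x. a *\<^sub>R \<tau> x + b *\<^sub>R \<rho> x) x = a * AG \<tau> x + b * AG \<rho> x)) \<and>
     (\<forall>\<tau>\<in>H1vec \<Omega>. \<tau> \<in> D \<and>
        (AE x in lebesgue_on \<Omega>.
           AG \<tau> x = (\<Sum>i\<in>UNIV. \<Sum>j\<in>UNIV. A x $ i $ j * weak_grad \<Omega> (\<lambda>y. \<tau> y $ i) x $ j)))"

definition Qspace ::
  "(real^'n) set \<Rightarrow> (real^'n \<Rightarrow> real^'n) set \<Rightarrow> ((real^'n \<Rightarrow> real^'n) \<Rightarrow> real^'n \<Rightarrow> real) \<Rightarrow>
   (real^'n \<Rightarrow> real^'n) set" where
  "Qspace \<Omega> D AG = {\<tau> \<in> L2 \<Omega> \<inter> D. AG \<tau> \<in> L2 \<Omega>}"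

text \<open>$A:D^2v$ is $A:\nabla(\nabla v)$.\<close>

definition Vspace ::
  "(real^'n) set \<Rightarrow> (real^'n \<Rightarrow> real^'n) set \<Rightarrow> ((real^'n \<Rightarrow> real^'n) \<Rightarrow> real^'n \<Rightarrow> real) \<Rightarrow>
   (real^'n \<Rightarrow> real) set" where
  "Vspace \<Omega> D AG = {v \<in> H10 \<Omega>. weak_grad \<Omega> v \<in> D \<and> AG (weak_grad \<Omega> v) \<in> L2 \<Omega>}"

definition solves ::
  "(real^'n) set \<Rightarrow> ((real^'n \<Rightarrow> real^'n) \<Rightarrow> real^'n \<Rightarrow> real) \<Rightarrow> (real^'n \<Rightarrow> real) \<Rightarrow>
   (real^'n \<Rightarrow> real) \<Rightarrow> bool" where
  "solves \<Omega> AG g v \<longleftrightarrow> (AE x in lebesgue_on \<Omega>. - AG (weak_grad \<Omega> v) x = g x)"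

definition well_posed ::
  "(real^'n) set \<Rightarrow> (real^'n \<Rightarrow> real^'n) set \<Rightarrow> ((real^'n \<Rightarrow> real^'n) \<Rightarrow> real^'n \<Rightarrow> real) \<Rightarrow> bool" where
  "well_posed \<Omega> D AG \<longleftrightarrow>
     (\<forall>g\<in>L2 \<Omega>. \<exists>v\<in>Vspace \<Omega> D AG. solves \<Omega> AG g v \<and>
        (\<forall>w\<in>Vspace \<Omega> D AG. solves \<Omega> AG g w \<longrightarrow> (AE x in lebesgue_on \<Omega>. w x = v x)))"

text \<open>Mesh elements are closed simplices of full dimension, meeting in common faces.\<close>

definition mesh :: "(real^'n) set \<Rightarrow> (real^'n) set set \<Rightarrow> bool" where
  "mesh \<Omega> \<T> \<longleftrightarrow> triangulation \<T> \<and> (\<forall>K\<in>\<T>. int CARD('n) simplex K) \<and> \<Union>\<T> = closure \<Omega>"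

definition shape_regular :: "real \<Rightarrow> (real^'n) set set \<Rightarrow> bool" where
  "shape_regular \<kappa> \<T> \<longleftrightarrow>
     (\<forall>K\<in>\<T>. diameter K \<le> \<kappa> * Sup {2 * r | r c. 0 \<le> r \<and> cball c r \<subseteq> K})"

definition S1 :: "(real^'n) set \<Rightarrow> (real^'n) set set \<Rightarrow> (real^'n \<Rightarrow> real) set" where
  "S1 \<Omega> \<T> = {v \<in> H1 \<Omega>. \<forall>K\<in>\<T>. \<exists>a b. AE x in lebesgue_on K. v x = a \<bullet> x + b}"

definition S10 :: "(real^'n) set \<Rightarrow> (real^'n) set set \<Rightarrow> (real^'n \<Rightarrow> real) set" where
  "S10 \<Omega> \<T> = S1 \<Omega> \<T> \<inter> H10 \<Omega>"

definition S1vec :: "(real^'n) set \<Rightarrow> (real^'n) set set \<Rightarrow> (real^'n \<Rightarrow> real^'n) set" where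
  "S1vec \<Omega> \<T> = {\<tau>. \<forall>i. (\<lambda>x. \<tau> x $ i) \<in> S1 \<Omega> \<T>}"

definition J0 ::
  "(real^'n) set \<Rightarrow> ((real^'n \<Rightarrow> real^'n) \<Rightarrow> real^'n \<Rightarrow> real) \<Rightarrow> (real^'n \<Rightarrow> real) \<Rightarrow>
   (real^'n \<Rightarrow> real) \<times> (real^'n \<Rightarrow> real^'n) \<Rightarrow> real" where
  "J0 \<Omega> AG f = (\<lambda>(v, \<tau>). (L2norm \<Omega> (\<lambda>x. f x + AG \<tau> x))\<^sup>2 +
                          (L2norm \<Omega> (\<lambda>x. \<tau> x - weak_grad \<Omega> v x))\<^sup>2)"

text \<open>In the next two definitions \<open>\<Omega>\<close> is the domain on which the weak derivatives are taken and
  \<open>\<omega>\<close> the set over which the norms are taken: an element, or \<open>\<Omega>\<close> itself.\<close>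

definition triple_norm ::
  "(real^'n) set \<Rightarrow> ((real^'n \<Rightarrow> real^'n) \<Rightarrow> real^'n \<Rightarrow> real) \<Rightarrow> (real^'n) set \<Rightarrow>
   (real^'n \<Rightarrow> real) \<Rightarrow> (real^'n \<Rightarrow> real^'n) \<Rightarrow> real" where
  "triple_norm \<Omega> AG \<omega> v \<tau> =
     sqrt ((L2norm \<omega> (AG \<tau>))\<^sup>2 + (L2norm \<omega> (\<lambda>x. \<tau> x - weak_grad \<Omega> v x))\<^sup>2)"

definition eta_loc ::
  "(real^'n) set \<Rightarrow> ((real^'n \<Rightarrow> real^'n) \<Rightarrow> real^'n \<Rightarrow> real) \<Rightarrow> (real^'n) set \<Rightarrow>
   (real^'n \<Rightarrow> real) \<Rightarrow> (real^'n \<Rightarrow> real) \<Rightarrow> (real^'n \<Rightarrow> real^'n) \<Rightarrow> real" where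
  "eta_loc \<Omega> AG \<omega> f v \<tau> =
     sqrt ((L2norm \<omega> (\<lambda>x. f x + AG \<tau> x))\<^sup>2 + (L2norm \<omega> (\<lambda>x. \<tau> x - weak_grad \<Omega> v x))\<^sup>2)"

definition eta_glob ::
  "(real^'n) set \<Rightarrow> ((real^'n \<Rightarrow> real^'n) \<Rightarrow> real^'n \<Rightarrow> real) \<Rightarrow> (real^'n) set set \<Rightarrow>
   (real^'n \<Rightarrow> real) \<Rightarrow> (real^'n \<Rightarrow> real) \<Rightarrow> (real^'n \<Rightarrow> real^'n) \<Rightarrow> real" where
  "eta_glob \<Omega> AG \<T> f v \<tau> = sqrt (\<Sum>K\<in>\<T>. (eta_loc \<Omega> AG K f v \<tau>)\<^sup>2)"

end

theory Submission
  imports Defs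
begin

text \<open>Well-posedness makes the continuous minimum of \<open>J0\<close> zero, so that $f + A:\nabla\sigma = 0$ and
  $\sigma = \nabla u$ almost everywhere. Substituting, the two residuals of the discrete pair become,
  up to sign, the two components of the error, pointwise almost everywhere; this gives the identities on
  every element and, since the elements tile the domain up to null sets, globally. The last bound is the
  triangle inequality for $(\sigma - \sigma_h) - \nabla(u - u_h)$. That $\nabla(u - u_h)$ may be split
  rests on the uniqueness of weak gradients, that is, on the fundamental lemma of the calculus of
  variations, for which products of the functions exp(-1/t) approximate the indicator functions of boxes.\<close>

section \<open>Smooth functions\<close>

lemma partial_deriv_eqI:
  assumes "(f has_derivative f') (at x)"
  shows "partial_deriv i f x = f' (axis i 1)"
  using frechet_derivative_at[OF assms] by (simp add: partial_deriv_def)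

text \<open>\<open>Ck (Suc k)\<close> records differentiability and the regularity of the partial
  derivatives, but not \<open>Ck k\<close> of the function itself; the induction bottoms out at
  continuity of differentiable functions.\<close>

lemma Ck_Suc_imp_Ck: "Ck (Suc k) f \<Longrightarrow> Ck k f"
proof (induction k arbitrary: f)
  case 0
  then show ?case by (auto intro: differentiable_imp_continuous_on)
next
  case (Suc k)
  then show ?case by auto
qed

lemma Ck_const: "Ck k (\<lambda>x. c)"
proof (induction k arbitrary: c)
  case (Suc k)
  have "partial_deriv i (\<lambda>x. c) = (\<lambda>x. 0)" for i :: 'a
    by (rule ext, subst partial_deriv_eqI[where f' = "\<lambda>x. 0"]) auto
  with Suc show ?case by simp
qed simp

lemma Ck_add: "Ck k f \<Longrightarrow> Ck k g \<Longrightarrow> Ck k (\<lambda>x. f x + g x)"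
proof (induction k arbitrary: f g)
  case 0
  then show ?case by (auto intro: continuous_intros)
next
  case (Suc k)
  have d: "\<And>x. f differentiable (at x)" "\<And>x. g differentiable (at x)"
    using Suc.prems by (auto simp: differentiable_on_def)
  have "partial_deriv i (\<lambda>x. f x + g x) = (\<lambda>x. partial_deriv i f x + partial_deriv i g x)" for i
  proof
    fix x
    show "partial_deriv i (\<lambda>x. f x + g x) x = partial_deriv i f x + partial_deriv i g x"
      using d[of x, unfolded frechet_derivative_works]
      by (subst partial_deriv_eqI[OF has_derivative_add]) (auto simp: partial_deriv_def)
  qed
  with Suc d show ?case by (auto simp: differentiable_on_def)
qed

lemma Ck_mult: "Ck k f \<Longrightarrow> Ck k g \<Longrightarrow> Ck k (\<lambda>x. f x * g x)"
proof (induction k arbitrary: f g)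
  case 0
  then show ?case by (auto intro: continuous_intros)
next
  case (Suc k)
  have d: "\<And>x. f differentiable (at x)" "\<And>x. g differentiable (at x)"
    using Suc.prems by (auto simp: differentiable_on_def)
  have eq: "partial_deriv i (\<lambda>x. f x * g x) = (\<lambda>x. f x * partial_deriv i g x + partial_deriv i f x * g x)" for i
  proof
    fix x
    show "partial_deriv i (\<lambda>x. f x * g x) x = f x * partial_deriv i g x + partial_deriv i f x * g x"
      using d[of x, unfolded frechet_derivative_works]
      by (subst partial_deriv_eqI[OF has_derivative_mult]) (auto simp: partial_deriv_def)
  qed
  \<comment> \<open>The product rule leaves \<open>f\<close> and \<open>g\<close> undifferentiated
    next to partial derivatives that are only \<open>Ck k\<close>, so their own order is lowered
    before the induction hypothesis applies.\<close>
  have "Ck k (partial_deriv i (\<lambda>x. f x * g x))" for i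
    unfolding eq using Suc.prems Suc.prems[THEN Ck_Suc_imp_Ck]
    by (intro Ck_add Suc.IH) auto
  with d show ?case by (auto simp: differentiable_on_def)
qed

lemma Ck_prod: "(\<And>i. i \<in> I \<Longrightarrow> Ck k (f i)) \<Longrightarrow> Ck k (\<lambda>x. \<Prod>i\<in>I. f i x)"
  by (induction I rule: infinite_finite_induct) (auto intro: Ck_const Ck_mult)

section \<open>The function exp(-1/t) and its derivatives\<close>

text \<open>These functions are closed under differentiation up to linear combinations, which makes
  the smoothness of exp(-1/t) an induction.\<close>

definition flat :: "nat \<Rightarrow> real \<Rightarrow> real" where
  "flat m t = (if t > 0 then inverse t ^ m * exp (- inverse t) else 0)"

text \<open>With s = 1/t this is the decay of s^m / exp s as s tends to infinity.\<close>

lemma tendsto_flat_0_right: "(flat m \<longlongrightarrow> 0) (at_right 0)"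
proof -
  have "((\<lambda>t::real. inverse t ^ m / exp (inverse t)) \<longlongrightarrow> 0) (at_right 0)"
    by (rule filterlim_compose[OF tendsto_power_div_exp_0 filterlim_inverse_at_top_right])
  moreover have "\<forall>\<^sub>F t in at_right 0. inverse t ^ m / exp (inverse t) = flat m t"
    using eventually_at_right_less by eventually_elim (simp add: flat_def exp_minus divide_inverse)
  ultimately show ?thesis
    by (rule Lim_transform_eventually)
qed

lemma tendsto_flat_0: "(flat m \<longlongrightarrow> 0) (at 0)"
proof -
  have "\<forall>\<^sub>F t in at_left 0. 0 = flat m t"
    by (intro eventually_at_leftI[of "-1"]) (auto simp: flat_def)
  then have "(flat m \<longlongrightarrow> 0) (at_left 0)"
    by (rule Lim_transform_eventually[OF tendsto_const])
  with tendsto_flat_0_right show ?thesis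
    by (simp add: filterlim_split_at)
qed

lemma has_real_derivative_flat:
  "(flat m has_real_derivative (flat (Suc (Suc m)) t - m * flat (Suc m) t)) (at t)"
proof (cases "t = 0")
  case True
  \<comment> \<open>The difference quotient at 0 is the next function of the family, whose limit at
    0 is already known.\<close>
  have "(flat m y - flat m 0) / (y - 0) = flat (Suc m) y" for y
    by (simp add: flat_def divide_inverse mult.commute mult.left_commute)
  with tendsto_flat_0[of "Suc m"] have "((\<lambda>y. (flat m y - flat m 0) / (y - 0)) \<longlongrightarrow> 0) (at 0)"
    by simp
  then have "(flat m has_real_derivative 0) (at 0)"
    by (simp only: has_field_derivative_iff)
  with True show ?thesis
    by (simp add: flat_def)
next
  case False
  then consider "t < 0" | "t > 0" by linarith
  then show ?thesis
  proof cases
    case 1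
    have "((\<lambda>t. 0) has_real_derivative 0) (at t)" by simp
    then have "(flat m has_real_derivative 0) (at t)"
      by (rule has_field_derivative_transform_within_open[where S = "{..<0}"]) (use 1 in \<open>auto simp: flat_def\<close>)
    with 1 show ?thesis by (simp add: flat_def)
  next
    case 2
    have "((\<lambda>t. inverse t ^ m * exp (- inverse t)) has_real_derivative
        (flat (Suc (Suc m)) t - m * flat (Suc m) t)) (at t)"
    proof (rule DERIV_cong)
      show "((\<lambda>t. inverse t ^ m * exp (- inverse t)) has_real_derivative
        (m * inverse t ^ (m - 1) * (- (inverse t)\<^sup>2)) * exp (- inverse t)
        + (exp (- inverse t) * (inverse t)\<^sup>2) * inverse t ^ m) (at t)"
        using 2 by (intro DERIV_mult) (auto intro!: derivative_eq_intros simp: power2_eq_square)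
      \<comment> \<open>The truncated exponent \<open>m - 1\<close> is off only for
        \<open>m = 0\<close>, where the factor \<open>m\<close> removes the term.\<close>
      have "m * inverse t ^ (m - 1) * (inverse t)\<^sup>2 = m * inverse t ^ Suc m"
        by (cases m) (simp_all add: power2_eq_square)
      with 2 show "(m * inverse t ^ (m - 1) * (- (inverse t)\<^sup>2)) * exp (- inverse t)
        + (exp (- inverse t) * (inverse t)\<^sup>2) * inverse t ^ m = flat (Suc (Suc m)) t - m * flat (Suc m) t"
        by (simp add: flat_def power2_eq_square)
    qed
    then show ?thesis
      by (rule has_field_derivative_transform_within_open[where S = "{0<..}"]) (use 2 in \<open>auto simp: flat_def\<close>)
  qed
qed

text \<open>\<open>m\<close> stays general in the induction, because differentiating
  \<open>flat m\<close> produces \<open>flat (Suc m)\<close> and \<open>flat (Suc (Suc m))\<close>;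
  the inner affine map contributes only constants.\<close>

lemma Ck_flat_affine: "Ck k (\<lambda>x::real^'n. flat m (c * x $ j + d))"
proof (induction k arbitrary: m)
  case 0
  have "continuous_on UNIV (flat m)"
    using has_real_derivative_flat by (meson DERIV_isCont continuous_at_imp_continuous_on)
  then show ?case
    unfolding Ck.simps
    by (rule continuous_on_compose2) (intro continuous_intros, simp)
next
  case (Suc k)
  have der: "((\<lambda>x::real^'n. flat m (c * x $ j + d)) has_derivative
     (\<lambda>h. (flat (Suc (Suc m)) (c * x $ j + d) - m * flat (Suc m) (c * x $ j + d)) * (c * h $ j))) (at x)" for x
    by (rule has_derivative_compose[OF _ has_real_derivative_flat[unfolded has_field_derivative_def], of "\<lambda>x::real^'n. c * x $ j + d"])
      (auto intro!: derivative_eq_intros bounded_linear_imp_has_derivative bounded_linear_vec_nth)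
  have eq: "partial_deriv i (\<lambda>x::real^'n. flat m (c * x $ j + d)) =
     (\<lambda>x. (flat (Suc (Suc m)) (c * x $ j + d) + (- real m) * flat (Suc m) (c * x $ j + d)) * (c * axis i 1 $ j))" for i
    by (rule ext, subst partial_deriv_eqI[OF der]) simp
  have "Ck k (partial_deriv i (\<lambda>x::real^'n. flat m (c * x $ j + d)))" for i
    unfolding eq by (intro Ck_add Ck_mult Ck_const Suc.IH)
  with der show ?case
    by (auto simp: differentiable_on_def differentiable_def)
qed

section \<open>The fundamental lemma of the calculus of variations\<close>

text \<open>Each face of the box contributes a factor exp(-1/s), where s is \<open>Suc k\<close>
  times the signed distance to the face. The nonzero set is the same open box for every
  \<open>k\<close>, while growing \<open>k\<close> drives the values inside it to 1, so indicators
  are approximated without convolution. The arguments are written in the form that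
  \<open>Ck_flat_affine\<close> expects.\<close>

definition box_bump :: "real^'n \<Rightarrow> real^'n \<Rightarrow> nat \<Rightarrow> real^'n \<Rightarrow> real" where
  "box_bump a b k x =
     (\<Prod>i\<in>UNIV. flat 0 (Suc k * x $ i + - (Suc k * a $ i)) * flat 0 (- real (Suc k) * x $ i + Suc k * b $ i))"

lemma flat_0_range: "0 \<le> flat 0 t" "flat 0 t \<le> 1"
  by (auto simp: flat_def)

lemma flat_0_eq_0_iff: "flat 0 t = 0 \<longleftrightarrow> t \<le> 0"
  by (auto simp: flat_def)

lemma box_bump_range: "0 \<le> box_bump a b k x" "box_bump a b k x \<le> 1"
  unfolding box_bump_def
  by (intro prod_nonneg prod_le_1 ballI conjI mult_nonneg_nonneg mult_le_one flat_0_range)+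

lemma box_bump_nonzero_iff: "box_bump a b k x \<noteq> 0 \<longleftrightarrow> x \<in> box a b"
proof -
  have "0 < Suc k * s + - (Suc k * t) \<longleftrightarrow> t < s" "0 < - real (Suc k) * s + Suc k * t \<longleftrightarrow> s < t" for s t :: real
    using mult_less_cancel_left_pos[of "real (Suc k)"] by (simp_all del: of_nat_Suc)
  then show ?thesis
    unfolding box_bump_def mem_box_cart by (simp add: flat_0_eq_0_iff not_le del: of_nat_Suc)
qed

text \<open>The nonzero set is the open box, so the support can reach the faces; this is why the
  closed box has to lie in \<open>\<Omega>\<close>.\<close>

lemma box_bump_test_function:
  assumes "cbox a b \<subseteq> \<Omega>"
  shows "box_bump a b k \<in> test_functions \<Omega>"
proof -
  have "Ck l (box_bump a b k)" for l
    unfolding box_bump_def by (intro Ck_prod Ck_mult Ck_flat_affine)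
  moreover have "closure (box a b) \<subseteq> cbox a b"
    by (intro closure_minimal box_subset_cbox closed_cbox)
  ultimately show ?thesis
    using assms bounded_subset[OF bounded_cbox]
    by (auto simp: test_functions_def box_bump_nonzero_iff)
qed

lemma tendsto_flat_0_1:
  fixes t :: real
  assumes "t > 0"
  shows "(\<lambda>k. flat 0 (Suc k * t)) \<longlonglongrightarrow> 1"
proof -
  have "(\<lambda>k. exp (- (inverse (real (Suc k)) * inverse t))) \<longlonglongrightarrow> exp (- (0 * inverse t))"
    by (intro tendsto_intros LIMSEQ_inverse_real_of_nat)
  with assms show ?thesis
    by (simp add: flat_def zero_less_mult_iff del: of_nat_Suc)
qed

lemma tendsto_box_bump: "(\<lambda>k. box_bump a b k x) \<longlonglongrightarrow> indicator (box a b) x"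
proof (cases "x \<in> box a b")
  case True
  have "(\<lambda>k. box_bump a b k x) \<longlonglongrightarrow> (\<Prod>i\<in>(UNIV::'a set). 1 * 1)"
    unfolding box_bump_def
  proof (intro tendsto_prod tendsto_mult)
    fix i
    show "(\<lambda>k. flat 0 (Suc k * x $ i + - (Suc k * a $ i))) \<longlonglongrightarrow> 1"
      using tendsto_flat_0_1[of "x $ i - a $ i"] True by (simp add: mem_box_cart algebra_simps)
    show "(\<lambda>k. flat 0 (- real (Suc k) * x $ i + Suc k * b $ i)) \<longlonglongrightarrow> 1"
      using tendsto_flat_0_1[of "b $ i - x $ i"] True by (simp add: mem_box_cart algebra_simps)
  qed
  with True show ?thesis by simp
next
  case False
  then have "box_bump a b k x = 0" for k
    using box_bump_nonzero_iff by blast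
  with False show ?thesis by simp
qed

text \<open>The Borel sets over which \<open>g\<close> integrates to 0 form a Dynkin system, and the
  open boxes are an intersection-stable generator of the Borel sets. Null sets extend this to all
  Lebesgue sets, and a density is determined almost everywhere by its integrals.\<close>

lemma AE_lebesgue_eq_0_if_box_integrals_eq_0:
  fixes g :: "'a::euclidean_space \<Rightarrow> real"
  assumes g: "integrable lebesgue g"
    and box: "\<And>a b. (LINT x:box a b|lebesgue. g x) = 0"
  shows "AE x in lebesgue. g x = 0"
proof (rule density_unique_real[OF g])
  show "integrable lebesgue (\<lambda>x::'a. 0::real)" by simp
  fix S :: "'a set" assume S: "S \<in> sets lebesgue"
  have int: "set_integrable lebesgue S g" if "S \<in> sets lebesgue" for S
    using integrable_mult_indicator[OF that g] by (simp add: set_integrable_def)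
  have lb: "S \<in> sets lebesgue" if "S \<in> sigma_sets UNIV (range (\<lambda>(a, b). box a b :: 'a set))" for S
    using that by (metis borel_eq_box sets_completionI_sets sets_lborel sets_measure_of subset_UNIV Pow_UNIV)
  \<comment> \<open>Complements in the Dynkin system are taken in the whole space, which is no box
    itself but an increasing union of boxes.\<close>
  have tot: "(LINT x:UNIV|lebesgue. g x) = 0"
  proof (rule LIMSEQ_unique)
    let ?A = "\<lambda>n::nat. box (- (real n *\<^sub>R One)) (real n *\<^sub>R One) :: 'a set"
    have "incseq ?A"
      by (intro incseq_SucI subset_box_imp) auto
    then have "(\<lambda>n. LINT x:?A n|lebesgue. g x) \<longlonglongrightarrow> (LINT x:(\<Union>n. ?A n)|lebesgue. g x)"
      by (intro set_integral_cont_up int) (auto simp: UN_box_eq_UNIV)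
    then show "(\<lambda>n. LINT x:?A n|lebesgue. g x) \<longlonglongrightarrow> (LINT x:UNIV|lebesgue. g x)"
      by (simp only: UN_box_eq_UNIV)
    show "(\<lambda>n. LINT x:?A n|lebesgue. g x) \<longlonglongrightarrow> 0"
      by (simp add: box)
  qed
  have borel: "(LINT x:S|lebesgue. g x) = 0" if "S \<in> sets borel" for S
  proof -
    have "Int_stable (range (\<lambda>(a, b). box a b :: 'a set))"
      by (auto simp: Int_stable_def box_Int_box)
    moreover have "range (\<lambda>(a, b). box a b :: 'a set) \<subseteq> Pow UNIV"
      by simp
    moreover have "S \<in> sigma_sets UNIV (range (\<lambda>(a, b). box a b))"
      using that by (simp add: borel_eq_box)
    ultimately show ?thesis
    proof (induction S rule: sigma_sets_induct_disjoint)
      case (basic A)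
      then show ?case using box by auto
    next
      case (compl A)
      have "(LINT x:UNIV|lebesgue. g x) = (LINT x:A|lebesgue. g x) + (LINT x:UNIV - A|lebesgue. g x)"
        using lb[OF compl(1)] by (subst set_integral_Un[symmetric]) (auto intro!: int)
      with compl tot show ?case by simp
    next
      case (union A)
      then have "A n \<in> sets lebesgue" for n
        using lb by auto
      with union(1) have "(LINT x:(\<Union>n. A n)|lebesgue. g x) = (\<Sum>n. LINT x:A n|lebesgue. g x)"
        by (intro lebesgue_integral_countable_add)
           (auto simp: disjoint_family_on_def intro!: int)
      with union show ?case by simp
    qed (auto simp: set_lebesgue_integral_def)
  qed
  \<comment> \<open>A Lebesgue set is a Borel set up to a subset of a Borel null set, which the
    integral does not see.\<close>
  obtain B N N' where B: "S = B \<union> N" "N \<subseteq> N'" "N' \<in> null_sets lborel" "B \<in> sets lborel"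
    using S by (rule sets_completionE)
  have "AE x in lebesgue. x \<notin> N'"
    using B(3) by (intro AE_not_in null_sets_completionI)
  then have "(LINT x:S|lebesgue. g x) = (LINT x:B|lebesgue. g x)"
    unfolding set_lebesgue_integral_def
    using S B g by (intro integral_cong_AE borel_measurable_scaleR borel_measurable_indicator)
      (auto simp: indicator_def)
  with borel B(4) show "(LINT x:S|lebesgue. g x) = (LINT x:S|lebesgue. 0)"
    by simp
qed

section \<open>Square integrable functions\<close>

lemma norm_add_square_le: "(norm (a + b))\<^sup>2 \<le> 2 * (norm a)\<^sup>2 + 2 * (norm (b::'a::real_normed_vector))\<^sup>2"
proof -
  have "(norm (a + b))\<^sup>2 \<le> (norm a + norm b)\<^sup>2"
    by (intro power_mono norm_triangle_ineq) simp
  also have "\<dots> \<le> 2 * (norm a)\<^sup>2 + 2 * (norm b)\<^sup>2"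
    using sum_squares_bound[of "norm a" "norm b"] by (simp add: power2_sum)
  finally show ?thesis .
qed

lemma L2I_bound:
  assumes "g \<in> borel_measurable (lebesgue_on \<omega>)" "integrable (lebesgue_on \<omega>) F"
    and "AE x in lebesgue_on \<omega>. (norm (g x))\<^sup>2 \<le> F x"
  shows "g \<in> L2 \<omega>"
proof -
  have "integrable (lebesgue_on \<omega>) (\<lambda>x. (norm (g x))\<^sup>2)"
    by (rule Bochner_Integration.integrable_bound[OF assms(2)]) (use assms in auto)
  with assms show ?thesis by (simp add: L2_def)
qed

lemma L2_add:
  assumes "f \<in> L2 \<omega>" "g \<in> L2 \<omega>"
  shows "(\<lambda>x. f x + g x) \<in> L2 \<omega>"
  using assms
  by (intro L2I_bound[where F = "\<lambda>x. 2 * (norm (f x))\<^sup>2 + 2 * (norm (g x))\<^sup>2"])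
    (auto simp: L2_def norm_add_square_le)

lemma L2_scaleR: "f \<in> L2 \<omega> \<Longrightarrow> (\<lambda>x. c *\<^sub>R f x) \<in> L2 \<omega>"
  by (auto simp add: L2_def power_mult_distrib)

lemma L2_diff:
  assumes "f \<in> L2 \<omega>" "g \<in> L2 \<omega>"
  shows "(\<lambda>x. f x - g x) \<in> L2 \<omega>"
  using L2_add[OF assms(1) L2_scaleR[OF assms(2), of "-1"]] by simp

lemma L2_sum: "(\<And>i. i \<in> I \<Longrightarrow> f i \<in> L2 \<omega>) \<Longrightarrow> (\<lambda>x. \<Sum>i\<in>I. f i x) \<in> L2 \<omega>"
proof (induction I rule: infinite_finite_induct)
  case (insert i I)
  then show ?case by (simp add: L2_add)
qed (simp_all add: L2_def)

lemma borel_measurable_vec_nth_comp: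
  "f \<in> borel_measurable M \<Longrightarrow> (\<lambda>x. f x $ i) \<in> borel_measurable M"
  by (rule borel_measurable_continuous_on[where f = "\<lambda>v. v $ i"]) (intro continuous_intros)

lemma L2_vec_nth:
  fixes f :: "real^'n \<Rightarrow> real^'m"
  assumes "f \<in> L2 \<omega>"
  shows "(\<lambda>x. f x $ i) \<in> L2 \<omega>"
proof (rule L2I_bound)
  have "(norm (f x $ i))\<^sup>2 \<le> (norm (f x))\<^sup>2" for x
    by (intro power_mono Finite_Cartesian_Product.norm_nth_le norm_ge_zero)
  then show "AE x in lebesgue_on \<omega>. (norm (f x $ i))\<^sup>2 \<le> (norm (f x))\<^sup>2"
    by simp
qed (use assms in \<open>simp_all add: L2_def borel_measurable_vec_nth_comp\<close>)

lemma L2_vecI: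
  fixes f :: "real^'n \<Rightarrow> real^'m"
  assumes "\<And>i. (\<lambda>x. f x $ i) \<in> L2 \<omega>"
  shows "f \<in> L2 \<omega>"
proof -
  have "(\<lambda>x. \<Sum>i\<in>UNIV. f x $ i *\<^sub>R axis i (1::real)) \<in> L2 \<omega>"
  proof (rule L2_sum)
    fix i
    show "(\<lambda>x. f x $ i *\<^sub>R axis i (1::real)) \<in> L2 \<omega>"
      using assms[of i] by (auto simp add: L2_def power_mult_distrib norm_axis_1)
  qed
  moreover have "(\<Sum>i\<in>UNIV. f x $ i *\<^sub>R axis i (1::real)) = f x" for x
    by (simp add: vec_eq_iff axis_def if_distrib cong: if_cong)
  ultimately show ?thesis by simp
qed

lemma L2_mult_integrable:
  fixes f g :: "real^'n \<Rightarrow> real"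
  assumes "f \<in> L2 \<omega>" "g \<in> L2 \<omega>"
  shows "integrable (lebesgue_on \<omega>) (\<lambda>x. f x * g x)"
proof (rule Bochner_Integration.integrable_bound)
  show "integrable (lebesgue_on \<omega>) (\<lambda>x. (f x)\<^sup>2 + (g x)\<^sup>2)"
    using assms by (auto simp: L2_def)
  have "\<bar>f x * g x\<bar> \<le> (f x)\<^sup>2 + (g x)\<^sup>2" for x
  proof -
    have "0 \<le> \<bar>f x\<bar> * \<bar>g x\<bar>" "2 * (\<bar>f x\<bar> * \<bar>g x\<bar>) \<le> (f x)\<^sup>2 + (g x)\<^sup>2"
      using sum_squares_bound[of "\<bar>f x\<bar>" "\<bar>g x\<bar>"] by simp_all
    then show ?thesis
      unfolding abs_mult by linarith
  qed
  then show "AE x in lebesgue_on \<omega>. norm (f x * g x) \<le> norm ((f x)\<^sup>2 + (g x)\<^sup>2)"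
    by simp
qed (use assms in \<open>auto simp add: L2_def\<close>)

lemma L2_Linf_mult:
  fixes f g :: "real^'n \<Rightarrow> real"
  assumes "f \<in> Linf \<omega>" "g \<in> L2 \<omega>"
  shows "(\<lambda>x. f x * g x) \<in> L2 \<omega>"
proof -
  obtain M where M: "AE x in lebesgue_on \<omega>. norm (f x) \<le> M"
    using assms by (auto simp: Linf_def)
  show ?thesis
  proof (rule L2I_bound)
    show "integrable (lebesgue_on \<omega>) (\<lambda>x. M\<^sup>2 * (norm (g x))\<^sup>2)"
      using assms by (auto simp: L2_def)
    show "AE x in lebesgue_on \<omega>. (norm (f x * g x))\<^sup>2 \<le> M\<^sup>2 * (norm (g x))\<^sup>2"
      using M
    proof eventually_elim
      case (elim x)
      then have "(norm (f x))\<^sup>2 \<le> M\<^sup>2"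
        by (intro power_mono) simp_all
      then show ?case
        unfolding norm_mult power_mult_distrib by (intro mult_right_mono) simp_all
    qed
  qed (use assms in \<open>auto simp: L2_def Linf_def\<close>)
qed

lemma Linf_vec_nth:
  fixes f :: "real^'n \<Rightarrow> 'b::euclidean_space^'m"
  assumes "f \<in> Linf \<omega>"
  shows "(\<lambda>x. f x $ i) \<in> Linf \<omega>"
proof -
  obtain M where "AE x in lebesgue_on \<omega>. norm (f x) \<le> M"
    using assms by (auto simp: Linf_def)
  then have "AE x in lebesgue_on \<omega>. norm (f x $ i) \<le> M"
    by eventually_elim (meson Finite_Cartesian_Product.norm_nth_le order_trans)
  with assms show ?thesis
    by (auto simp: Linf_def intro: borel_measurable_vec_nth_comp)
qed

section \<open>Changing functions on null sets\<close>

lemma lebesgue_on_complete: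
  assumes "S \<in> sets lebesgue"
  shows "complete_measure (lebesgue_on S)"
proof
  fix B A assume *: "B \<subseteq> A" "A \<in> null_sets (lebesgue_on S)"
  then have "A \<in> null_sets lebesgue" "A \<subseteq> S"
    using assms by (auto simp: null_sets_restrict_space)
  with * have "B \<in> null_sets lebesgue" "B \<subseteq> S"
    using completion.complete2[of B A] by auto
  then show "B \<in> sets (lebesgue_on S)"
    using assms by (auto simp: sets_restrict_space_iff)
qed

text \<open>Preimages under \<open>f\<close> and \<open>g\<close> differ by a null set, and
  completeness makes every such modification measurable. This matters because the operator and the
  weak gradient are known only almost everywhere.\<close>

lemma borel_measurable_lebesgue_on_AE:
  assumes S: "S \<in> sets lebesgue" and f: "f \<in> borel_measurable (lebesgue_on S)"
    and eq: "AE x in lebesgue_on S. g x = f x"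
  shows "g \<in> borel_measurable (lebesgue_on S)"
proof -
  interpret complete_measure "lebesgue_on S"
    by (rule lebesgue_on_complete[OF S])
  show ?thesis
  proof (rule measurableI)
    fix B :: "'b set" assume B: "B \<in> sets borel"
    show "g -` B \<inter> space (lebesgue_on S) \<in> sets (lebesgue_on S)"
    proof (rule in_sets_AE)
      show "f -` B \<inter> space (lebesgue_on S) \<in> sets (lebesgue_on S)"
        using f B by (rule measurable_sets)
      show "AE x in lebesgue_on S. x \<in> f -` B \<inter> space (lebesgue_on S) \<longleftrightarrow> x \<in> g -` B \<inter> space (lebesgue_on S)"
        using eq by eventually_elim auto
    qed auto
  qed simp
qed

lemma L2_cong_AE:
  assumes "S \<in> sets lebesgue" "f \<in> L2 S" "AE x in lebesgue_on S. g x = f x"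
  shows "g \<in> L2 S"
proof (rule L2I_bound)
  show "g \<in> borel_measurable (lebesgue_on S)"
    using assms by (intro borel_measurable_lebesgue_on_AE[of S f g]) (auto simp: L2_def)
  show "integrable (lebesgue_on S) (\<lambda>x. (norm (f x))\<^sup>2)"
    using assms by (simp add: L2_def)
  show "AE x in lebesgue_on S. (norm (g x))\<^sup>2 \<le> (norm (f x))\<^sup>2"
    using assms(3) by eventually_elim simp
qed

lemma L2norm_nonneg: "0 \<le> L2norm \<omega> g"
  by (simp add: L2norm_def)

lemma L2norm_square: "(L2norm \<omega> g)\<^sup>2 = (\<integral>x. (norm (g x))\<^sup>2 \<partial>lebesgue_on \<omega>)"
  by (simp add: L2norm_def)

text \<open>No measurability is needed on a complete measure space, where both integrals are junk together.\<close>

lemma L2norm_cong_AE: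
  assumes S: "S \<in> sets lebesgue" and eq: "AE x in lebesgue_on S. norm (g x) = norm (f x)"
  shows "L2norm S g = L2norm S f"
proof -
  let ?G = "\<lambda>x. (norm (g x))\<^sup>2" and ?F = "\<lambda>x. (norm (f x))\<^sup>2"
  have ae: "AE x in lebesgue_on S. ?G x = ?F x" "AE x in lebesgue_on S. ?F x = ?G x"
    using eq by (eventually_elim, simp)+
  have "integral\<^sup>L (lebesgue_on S) ?G = integral\<^sup>L (lebesgue_on S) ?F"
  proof (cases "?G \<in> borel_measurable (lebesgue_on S)")
    case True
    then show ?thesis
      using borel_measurable_lebesgue_on_AE[OF S True ae(2)] ae(1) by (rule integral_cong_AE)
  next
    case False
    then have "?F \<notin> borel_measurable (lebesgue_on S)"
      using borel_measurable_lebesgue_on_AE[OF S _ ae(1)] by blast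
    with False show ?thesis
      using borel_measurable_integrable not_integrable_integral_eq by metis
  qed
  then show ?thesis by (simp add: L2norm_def)
qed

lemma L2norm_eq_0D:
  assumes "f \<in> L2 \<omega>" "L2norm \<omega> f = 0"
  shows "AE x in lebesgue_on \<omega>. f x = 0"
proof -
  have "(\<integral>x. (norm (f x))\<^sup>2 \<partial>lebesgue_on \<omega>) = 0"
    using assms(2) L2norm_square[of \<omega> f] by simp
  then have "AE x in lebesgue_on \<omega>. (norm (f x))\<^sup>2 = 0"
    using assms(1) by (subst (asm) integral_nonneg_eq_0_iff_AE) (auto simp: L2_def)
  then show ?thesis by simp
qed

lemma L2norm_eq_0I: "AE x in lebesgue_on \<omega>. f x = 0 \<Longrightarrow> L2norm \<omega> f = 0"
  unfolding L2norm_def by (subst integral_eq_zero_AE) auto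

text \<open>Integrating a pointwise inequality replaces Minkowski's inequality; the factor 2 is
  absorbed by the constant of the efficiency bound.\<close>

lemma L2norm_diff_square_le:
  assumes "f \<in> L2 \<omega>" "g \<in> L2 \<omega>"
  shows "(L2norm \<omega> (\<lambda>x. f x - g x))\<^sup>2 \<le> 2 * (L2norm \<omega> f)\<^sup>2 + 2 * (L2norm \<omega> g)\<^sup>2"
proof -
  have "(norm (f x - g x))\<^sup>2 \<le> 2 * (norm (f x))\<^sup>2 + 2 * (norm (g x))\<^sup>2" for x
    using norm_add_square_le[of "f x" "- g x"] by simp
  then have "(\<integral>x. (norm (f x - g x))\<^sup>2 \<partial>lebesgue_on \<omega>)
      \<le> (\<integral>x. 2 * (norm (f x))\<^sup>2 + 2 * (norm (g x))\<^sup>2 \<partial>lebesgue_on \<omega>)"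
    using assms L2_diff[OF assms] by (intro integral_mono) (auto simp: L2_def)
  also have "\<dots> = 2 * (\<integral>x. (norm (f x))\<^sup>2 \<partial>lebesgue_on \<omega>) + 2 * (\<integral>x. (norm (g x))\<^sup>2 \<partial>lebesgue_on \<omega>)"
    using assms by (auto simp: L2_def)
  finally show ?thesis by (simp add: L2norm_square)
qed

section \<open>Weak gradients\<close>

lemma L2_continuous_compact_support:
  fixes f :: "real^'n \<Rightarrow> real"
  assumes f: "continuous_on UNIV f" and K: "compact K" "\<And>x. x \<notin> K \<Longrightarrow> f x = 0"
    and S: "S \<in> sets lebesgue"
  shows "f \<in> L2 S"
proof -
  have "integrable lborel (\<lambda>x. indicator K x *\<^sub>R (f x)\<^sup>2)"
    by (intro borel_integrable_compact K continuous_intros continuous_on_subset[OF f]) auto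
  moreover have "(\<lambda>x. indicator K x *\<^sub>R (f x)\<^sup>2) = (\<lambda>x. (f x)\<^sup>2)"
    using K(2) by (auto simp: indicator_def fun_eq_iff)
  ultimately have "integrable lborel (\<lambda>x. (f x)\<^sup>2)"
    by simp
  then have "integrable lebesgue (\<lambda>x. (f x)\<^sup>2)"
    by (subst integrable_completion) (auto dest: borel_measurable_integrable)
  then have "integrable lebesgue (\<lambda>x. indicator S x *\<^sub>R (f x)\<^sup>2)"
    using S by (intro integrable_mult_indicator)
  then have "integrable (lebesgue_on S) (\<lambda>x. (f x)\<^sup>2)"
    using S by (subst integrable_restrict_space) auto
  moreover have "f \<in> borel_measurable (lebesgue_on S)"
    using borel_measurable_continuous_onI[OF f] by (intro measurable_restrict_space1 measurable_completion) simp
  ultimately show ?thesis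
    by (simp add: L2_def)
qed

text \<open>Both memberships make the products in \<open>is_weak_grad\<close> integrable, so that
  these integrals may be split linearly.\<close>

lemma test_functions_L2:
  assumes \<phi>: "\<phi> \<in> test_functions \<Omega>" and S: "S \<in> sets lebesgue"
  shows "\<phi> \<in> L2 S" and "partial_deriv i \<phi> \<in> L2 S"
proof -
  define K where "K = closure {x. \<phi> x \<noteq> 0}"
  have K: "compact K" and Ck: "Ck k \<phi>" for k
    using \<phi> by (auto simp: test_functions_def K_def)
  have zero: "\<phi> x = 0" if "x \<notin> K" for x
    using that closure_subset[of "{x. \<phi> x \<noteq> 0}"] by (auto simp: K_def)
  show "\<phi> \<in> L2 S"
    using Ck[of 0] by (intro L2_continuous_compact_support[OF _ K zero S]) simp_all
  \<comment> \<open>Off its closed support the function vanishes on a neighbourhood of the point,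
    hence so does its derivative there.\<close>
  have "partial_deriv i \<phi> x = 0" if x: "x \<notin> K" for x
  proof -
    have "(\<phi> has_derivative (\<lambda>h. 0)) (at x)"
      by (rule has_derivative_transform_within_open[OF has_derivative_const[of 0], where s = "- K"])
        (use x zero K in \<open>auto simp: compact_imp_closed\<close>)
    then show ?thesis
      by (simp add: partial_deriv_eqI)
  qed
  then show "partial_deriv i \<phi> \<in> L2 S"
    using Ck[of 1] by (intro L2_continuous_compact_support[OF _ K _ S]) simp_all
qed

text \<open>The bumps converge to the indicator of the box and stay below it, so dominated
  convergence carries the vanishing integrals over from test functions to boxes.\<close>

lemma box_integral_eq_0:
  fixes h :: "real^'n \<Rightarrow> real"
  assumes S: "\<Omega> \<in> sets lebesgue" and h: "h \<in> L2 \<Omega>"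
    and test: "\<And>\<phi>. \<phi> \<in> test_functions \<Omega> \<Longrightarrow> (\<integral>x. h x * \<phi> x \<partial>lebesgue_on \<Omega>) = 0"
    and ab: "cbox a b \<subseteq> \<Omega>"
  shows "integrable lebesgue (\<lambda>x. indicator (box a b) x * h x)"
    and "(LINT x:box a b|lebesgue. h x) = 0"
proof -
  \<comment> \<open>A bounded box has finite measure, so its indicator is square integrable and the
    product with \<open>h\<close> is integrable, even where \<open>h\<close> alone is merely square
    integrable.\<close>
  have "integrable (lebesgue_on \<Omega>) (indicator (box a b) :: _ \<Rightarrow> real)"
    using S by (subst integrable_restrict_space)
      (auto simp: indicator_inter_arith[symmetric] emeasure_lborel_box_eq intro!: integrable_real_indicator
        intro: le_less_trans[OF emeasure_mono[of _ "box a b"]])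
  moreover have "(norm (indicator (box a b) x :: real))\<^sup>2 = indicator (box a b) x" for x
    by (simp add: indicator_def)
  ultimately have "(indicator (box a b) :: _ \<Rightarrow> real) \<in> L2 \<Omega>"
    by (simp add: L2_def borel_measurable_integrable)
  with h have int: "integrable (lebesgue_on \<Omega>) (\<lambda>x. h x * indicator (box a b) x)"
    by (rule L2_mult_integrable)
  have ind: "indicator \<Omega> x *\<^sub>R (h x * indicator (box a b) x) = indicator (box a b) x * h x" for x
    using ab box_subset_cbox[of a b] by (auto simp: indicator_def)
  have S': "\<Omega> \<inter> space lebesgue \<in> sets lebesgue"
    using S by simp
  show "integrable lebesgue (\<lambda>x. indicator (box a b) x * h x)"
    using int unfolding integrable_restrict_space[OF S'] ind .
  have "(\<lambda>k. \<integral>x. h x * box_bump a b k x \<partial>lebesgue_on \<Omega>)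
      \<longlonglongrightarrow> (\<integral>x. h x * indicator (box a b) x \<partial>lebesgue_on \<Omega>)"
  proof (rule integral_dominated_convergence)
    show "(\<lambda>x. h x * indicator (box a b) x) \<in> borel_measurable (lebesgue_on \<Omega>)"
      using int by auto
    show "(\<lambda>x. h x * box_bump a b k x) \<in> borel_measurable (lebesgue_on \<Omega>)" for k
      using L2_mult_integrable[OF h test_functions_L2(1)[OF box_bump_test_function[OF ab] S]] by auto
    show "integrable (lebesgue_on \<Omega>) (\<lambda>x. \<bar>h x * indicator (box a b) x\<bar>)"
      using int by (rule integrable_abs)
    show "AE x in lebesgue_on \<Omega>. (\<lambda>k. h x * box_bump a b k x) \<longlonglongrightarrow> h x * indicator (box a b) x"
      by (intro always_eventually allI tendsto_intros tendsto_box_bump)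
    have "\<bar>box_bump a b k x\<bar> \<le> indicator (box a b) x" for k x
      using box_bump_range[of a b k x] box_bump_nonzero_iff[of a b k x] by (auto simp: indicator_def)
    then show "AE x in lebesgue_on \<Omega>. norm (h x * box_bump a b k x) \<le> \<bar>h x * indicator (box a b) x\<bar>" for k
      by (intro always_eventually allI) (simp add: abs_mult mult_left_mono)
  qed
  then have "(\<integral>x. h x * indicator (box a b) x \<partial>lebesgue_on \<Omega>) = 0"
    using test[OF box_bump_test_function[OF ab]] by (simp add: LIMSEQ_const_iff)
  then show "(LINT x:box a b|lebesgue. h x) = 0"
    unfolding integral_restrict_space[OF S'] ind by (simp add: set_lebesgue_integral_def)
qed

text \<open>The claim is local: it is proved on each closed box inside \<open>\<Omega>\<close>, and
  countably many of these cover the open set.\<close>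

lemma fundamental_lemma_calculus_of_variations:
  fixes h :: "real^'n \<Rightarrow> real"
  assumes \<Omega>: "open \<Omega>" and h: "h \<in> L2 \<Omega>"
    and test: "\<And>\<phi>. \<phi> \<in> test_functions \<Omega> \<Longrightarrow> (\<integral>x. h x * \<phi> x \<partial>lebesgue_on \<Omega>) = 0"
  shows "AE x in lebesgue_on \<Omega>. h x = 0"
proof -
  have S: "\<Omega> \<in> sets lebesgue"
    using \<Omega> by simp
  have box: "AE x in lebesgue. x \<in> cbox a b \<longrightarrow> h x = 0" if ab: "cbox a b \<subseteq> \<Omega>" for a b
  proof -
    have "AE x in lebesgue. indicator (box a b) x * h x = 0"
    proof (rule AE_lebesgue_eq_0_if_box_integrals_eq_0)
      show "integrable lebesgue (\<lambda>x. indicator (box a b) x * h x)"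
        by (rule box_integral_eq_0[OF S h test ab])
      fix c d
      obtain c' d' where cd: "box c d \<inter> box a b = box c' d'"
        by (simp add: box_Int_box)
      have "(LINT x:box c' d'|lebesgue. h x) = 0"
      \<comment> \<open>An empty open box may have a nonempty closed box with the same corners,
        possibly outside \<open>\<Omega>\<close>; only for nonempty boxes is the closed box the
        closure of the open one.\<close>
      proof (cases "box c' d' = {}")
        case False
        have "closure (box c' d') \<subseteq> cbox a b"
          using cd box_subset_cbox[of a b] by (intro closure_minimal) auto
        with False have "cbox c' d' \<subseteq> cbox a b"
          by simp
        with ab show ?thesis
          by (intro box_integral_eq_0(2)[OF S h test]) auto
      qed (simp add: set_lebesgue_integral_def)
      then show "(LINT x:box c d|lebesgue. indicator (box a b) x * h x) = 0"
        by (simp add: cd[symmetric] set_lebesgue_integral_def indicator_inter_arith mult.assoc)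
    qed
    \<comment> \<open>The covering uses closed boxes, the integrals open ones; the faces between
      them are null.\<close>
    moreover have "AE x in lebesgue. x \<notin> cbox a b - box a b"
      using negligible_frontier_interval[of a b] by (intro AE_not_in) (simp add: negligible_iff_null_sets)
    ultimately show ?thesis
      by eventually_elim (auto simp: indicator_def split: if_splits)
  qed
  obtain \<D> where D: "countable \<D>" "\<D> \<subseteq> Pow \<Omega>" "\<And>X. X \<in> \<D> \<Longrightarrow> \<exists>a b. X = cbox a b" "\<Union>\<D> = \<Omega>"
    using open_countable_Union_open_cbox[OF \<Omega>] by metis
  have "AE x in lebesgue. x \<in> X \<longrightarrow> h x = 0" if "X \<in> \<D>" for X
    using box D(2,3) that by blast
  then have "AE x in lebesgue. \<forall>X\<in>\<D>. x \<in> X \<longrightarrow> h x = 0"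
    using D(1) by (subst AE_ball_countable) auto
  then have "AE x in lebesgue. x \<in> \<Omega> \<longrightarrow> h x = 0"
    by eventually_elim (use D(4) in blast)
  then show ?thesis
    using S by (subst AE_restrict_space_iff) auto
qed

lemma weak_grad_is_weak_grad: "v \<in> H1 \<Omega> \<Longrightarrow> is_weak_grad \<Omega> v (weak_grad \<Omega> v)"
  unfolding weak_grad_def H1_def by (simp add: someI_ex)

lemma weak_grad_L2: "v \<in> H1 \<Omega> \<Longrightarrow> weak_grad \<Omega> v \<in> L2 \<Omega>"
  using weak_grad_is_weak_grad by (auto simp: is_weak_grad_def)

text \<open>Componentwise, the two gradients have the same integrals against every test function, so
  the fundamental lemma applies to their difference.\<close>

lemma is_weak_grad_unique:
  assumes \<Omega>: "open \<Omega>" and g: "is_weak_grad \<Omega> v g" "is_weak_grad \<Omega> v g'"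
  shows "AE x in lebesgue_on \<Omega>. g x = g' x"
proof -
  have S: "\<Omega> \<in> sets lebesgue"
    using \<Omega> by simp
  have L2: "(\<lambda>x. g x $ i) \<in> L2 \<Omega>" "(\<lambda>x. g' x $ i) \<in> L2 \<Omega>" for i
    using g by (auto simp: is_weak_grad_def intro: L2_vec_nth)
  have "AE x in lebesgue_on \<Omega>. g x $ i - g' x $ i = 0" for i
  proof (rule fundamental_lemma_calculus_of_variations[OF \<Omega> L2_diff[OF L2]])
    fix \<phi> assume \<phi>: "\<phi> \<in> test_functions \<Omega>"
    have "(\<integral>x. (g x $ i - g' x $ i) * \<phi> x \<partial>lebesgue_on \<Omega>)
        = (\<integral>x. g x $ i * \<phi> x \<partial>lebesgue_on \<Omega>) - (\<integral>x. g' x $ i * \<phi> x \<partial>lebesgue_on \<Omega>)"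
      unfolding left_diff_distrib
      by (intro Bochner_Integration.integral_diff L2_mult_integrable L2 test_functions_L2[OF \<phi> S])
    also have "\<dots> = 0"
    proof -
      have "(\<integral>x. v x * partial_deriv i \<phi> x \<partial>lebesgue_on \<Omega>) = - (\<integral>x. g x $ i * \<phi> x \<partial>lebesgue_on \<Omega>)"
        using g(1) \<phi> by (simp add: is_weak_grad_def)
      moreover have "(\<integral>x. v x * partial_deriv i \<phi> x \<partial>lebesgue_on \<Omega>) = - (\<integral>x. g' x $ i * \<phi> x \<partial>lebesgue_on \<Omega>)"
        using g(2) \<phi> by (simp add: is_weak_grad_def)
      ultimately show ?thesis by linarith
    qed
    finally show "(\<integral>x. (g x $ i - g' x $ i) * \<phi> x \<partial>lebesgue_on \<Omega>) = 0" .
  qed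
  then have "AE x in lebesgue_on \<Omega>. \<forall>i. g x $ i - g' x $ i = 0"
    by (subst AE_all_countable) simp
  then show ?thesis
    by eventually_elim (simp add: vec_eq_iff)
qed

lemma is_weak_grad_diff:
  assumes S: "\<Omega> \<in> sets lebesgue" and L2: "v \<in> L2 \<Omega>" "w \<in> L2 \<Omega>"
    and grad: "is_weak_grad \<Omega> v g" "is_weak_grad \<Omega> w g'"
  shows "is_weak_grad \<Omega> (\<lambda>x. v x - w x) (\<lambda>x. g x - g' x)"
  unfolding is_weak_grad_def
proof (intro conjI ballI allI)
  have g: "g \<in> L2 \<Omega>" "g' \<in> L2 \<Omega>"
    using grad by (auto simp: is_weak_grad_def)
  then show "(\<lambda>x. g x - g' x) \<in> L2 \<Omega>"
    by (rule L2_diff)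
  fix \<phi> i assume \<phi>: "\<phi> \<in> test_functions \<Omega>"
  note t = test_functions_L2[OF \<phi> S]
  have "(\<integral>x. (v x - w x) * partial_deriv i \<phi> x \<partial>lebesgue_on \<Omega>)
      = (\<integral>x. v x * partial_deriv i \<phi> x \<partial>lebesgue_on \<Omega>) - (\<integral>x. w x * partial_deriv i \<phi> x \<partial>lebesgue_on \<Omega>)"
    unfolding left_diff_distrib
    by (intro Bochner_Integration.integral_diff L2_mult_integrable L2 t)
  also have "\<dots> = - ((\<integral>x. g x $ i * \<phi> x \<partial>lebesgue_on \<Omega>) - (\<integral>x. g' x $ i * \<phi> x \<partial>lebesgue_on \<Omega>))"
    using grad \<phi> by (simp add: is_weak_grad_def)
  also have "\<dots> = - (\<integral>x. (g x - g' x) $ i * \<phi> x \<partial>lebesgue_on \<Omega>)"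
    unfolding vector_minus_component left_diff_distrib
    by (subst Bochner_Integration.integral_diff) (intro L2_mult_integrable L2_vec_nth g t refl)+
  finally show "(\<integral>x. (v x - w x) * partial_deriv i \<phi> x \<partial>lebesgue_on \<Omega>)
      = - (\<integral>x. (g x - g' x) $ i * \<phi> x \<partial>lebesgue_on \<Omega>)" .
qed

text \<open>\<open>weak_grad\<close> is chosen separately for each function, so it is additive only
  almost everywhere. The difference of the chosen gradients is one weak gradient of
  \<open>v - w\<close>, and uniqueness identifies it with the chosen one.\<close>

lemma weak_grad_diff:
  assumes \<Omega>: "open \<Omega>" and v: "v \<in> H1 \<Omega>" and w: "w \<in> H1 \<Omega>"
  shows "AE x in lebesgue_on \<Omega>. weak_grad \<Omega> (\<lambda>x. v x - w x) x = weak_grad \<Omega> v x - weak_grad \<Omega> w x"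
proof -
  have L2: "v \<in> L2 \<Omega>" "w \<in> L2 \<Omega>"
    using v w by (auto simp: H1_def)
  have diff: "is_weak_grad \<Omega> (\<lambda>x. v x - w x) (\<lambda>x. weak_grad \<Omega> v x - weak_grad \<Omega> w x)"
    using \<Omega> by (intro is_weak_grad_diff L2 weak_grad_is_weak_grad v w) simp
  then have "(\<lambda>x. v x - w x) \<in> H1 \<Omega>"
    using L2 by (auto simp: H1_def intro: L2_diff)
  then show ?thesis
    using is_weak_grad_unique[OF \<Omega> weak_grad_is_weak_grad diff] by blast
qed

section \<open>Restriction to mesh elements\<close>

text \<open>Mesh elements are closed and may contain boundary points of the open domain, so they are
  subsets of it only up to null sets. This lemma and the next three transfer properties to such
  sets.\<close>

lemma AE_lebesgue_on_almost_subset: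
  assumes S: "S \<in> sets lebesgue" "K \<in> sets lebesgue" and null: "negligible (K - S)"
    and P: "AE x in lebesgue_on S. P x"
  shows "AE x in lebesgue_on K. P x"
proof -
  have "AE x in lebesgue. x \<in> S \<longrightarrow> P x"
    using P S by (subst (asm) AE_restrict_space_iff) auto
  moreover have "AE x in lebesgue. x \<notin> K - S"
    using null by (intro AE_not_in) (simp add: negligible_iff_null_sets)
  ultimately have "AE x in lebesgue. x \<in> K \<longrightarrow> P x"
    by eventually_elim auto
  then show ?thesis
    using S by (subst AE_restrict_space_iff) auto
qed

lemma borel_measurable_lebesgue_on_almost_subset:
  fixes f :: "'a::euclidean_space \<Rightarrow> 'b::euclidean_space"
  assumes S: "S \<in> sets lebesgue" "K \<in> sets lebesgue" and null: "negligible (K - S)"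
    and f: "f \<in> borel_measurable (lebesgue_on S)"
  shows "f \<in> borel_measurable (lebesgue_on K)"
proof (rule borel_measurable_lebesgue_on_AE[OF S(2)])
  have "(\<lambda>x. indicator S x *\<^sub>R f x) \<in> borel_measurable lebesgue"
    using f S by (subst (asm) borel_measurable_restrict_space_iff) auto
  then show "(\<lambda>x. indicator S x *\<^sub>R f x) \<in> borel_measurable (lebesgue_on K)"
    by (rule measurable_restrict_space1)
  show "AE x in lebesgue_on K. f x = indicator S x *\<^sub>R f x"
    by (rule AE_lebesgue_on_almost_subset[OF S null]) (simp add: AE_restrict_space_iff S)
qed

lemma integrable_lebesgue_on_almost_subset:
  fixes f :: "'a::euclidean_space \<Rightarrow> 'b::euclidean_space"
  assumes S: "S \<in> sets lebesgue" "K \<in> sets lebesgue" and null: "negligible (K - S)"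
    and f: "integrable (lebesgue_on S) f"
  shows "integrable (lebesgue_on K) f"
proof -
  have K: "f \<in> borel_measurable (lebesgue_on K)"
    using f by (intro borel_measurable_lebesgue_on_almost_subset[OF S null]) auto
  have "integrable lebesgue (\<lambda>x. indicator S x *\<^sub>R f x)"
    using f S by (subst (asm) integrable_restrict_space) auto
  then have "integrable lebesgue (\<lambda>x. indicator K x *\<^sub>R f x)"
  proof (rule Bochner_Integration.integrable_bound)
    show "(\<lambda>x. indicator K x *\<^sub>R f x) \<in> borel_measurable lebesgue"
      using K S by (subst (asm) borel_measurable_restrict_space_iff) auto
    have "AE x in lebesgue. x \<notin> K - S"
      using null by (intro AE_not_in) (simp add: negligible_iff_null_sets)
    then show "AE x in lebesgue. norm (indicator K x *\<^sub>R f x) \<le> norm (indicator S x *\<^sub>R f x)"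
      by eventually_elim (auto simp: indicator_def)
  qed
  then show ?thesis
    using S by (subst integrable_restrict_space) auto
qed

lemma L2_almost_subset:
  assumes S: "S \<in> sets lebesgue" "K \<in> sets lebesgue" and null: "negligible (K - S)"
    and f: "f \<in> L2 S"
  shows "f \<in> L2 K"
  using f integrable_lebesgue_on_almost_subset[OF S null] borel_measurable_lebesgue_on_almost_subset[OF S null]
  by (auto simp: L2_def)

lemma integral_almost_partition:
  fixes F :: "'a::euclidean_space \<Rightarrow> real"
  assumes fin: "finite \<T>" and S: "S \<in> sets lebesgue" "\<And>K. K \<in> \<T> \<Longrightarrow> K \<in> sets lebesgue"
    and sub: "S \<subseteq> \<Union>\<T>" "\<And>K. K \<in> \<T> \<Longrightarrow> negligible (K - S)"
    and disj: "\<And>K L. K \<in> \<T> \<Longrightarrow> L \<in> \<T> \<Longrightarrow> K \<noteq> L \<Longrightarrow> negligible (K \<inter> L)"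
    and F: "integrable (lebesgue_on S) F"
  shows "(\<integral>x. F x \<partial>lebesgue_on S) = (\<Sum>K\<in>\<T>. \<integral>x. F x \<partial>lebesgue_on K)"
proof -
  have int: "integrable lebesgue (\<lambda>x. indicator K x *\<^sub>R F x)" if "K \<in> \<T>" for K
    using integrable_lebesgue_on_almost_subset[OF S(1) S(2)[OF that] sub(2)[OF that] F] S(2)[OF that]
    by (subst (asm) integrable_restrict_space) auto
  \<comment> \<open>Off this null set no element sticks out of \<open>S\<close> and no two elements
    overlap, so exactly one indicator is 1 at a point of \<open>S\<close> and none is
    elsewhere.\<close>
  let ?N = "(\<Union>K\<in>\<T>. K - S) \<union> (\<Union>(K, L)\<in>{(K, L). K \<in> \<T> \<and> L \<in> \<T> \<and> K \<noteq> L}. K \<inter> L)"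
  have "finite {(K, L). K \<in> \<T> \<and> L \<in> \<T> \<and> K \<noteq> L}"
    by (rule finite_subset[of _ "\<T> \<times> \<T>"]) (use fin in auto)
  then have "negligible ?N"
    using fin sub(2) disj by (intro negligible_Un negligible_Union) auto
  then have N: "AE x in lebesgue. x \<notin> ?N"
    by (intro AE_not_in) (simp add: negligible_iff_null_sets)
  have "(\<integral>x. F x \<partial>lebesgue_on S) = (\<integral>x. indicator S x *\<^sub>R F x \<partial>lebesgue)"
    using S(1) by (subst integral_restrict_space) auto
  also have "\<dots> = (\<integral>x. (\<Sum>K\<in>\<T>. indicator K x *\<^sub>R F x) \<partial>lebesgue)"
  proof (rule integral_cong_AE)
    show "(\<lambda>x. indicator S x *\<^sub>R F x) \<in> borel_measurable lebesgue"
      using F S(1) by (subst (asm) integrable_restrict_space) auto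
    show "(\<lambda>x. \<Sum>K\<in>\<T>. indicator K x *\<^sub>R F x) \<in> borel_measurable lebesgue"
      using int by (intro borel_measurable_sum) auto
    show "AE x in lebesgue. indicator S x *\<^sub>R F x = (\<Sum>K\<in>\<T>. indicator K x *\<^sub>R F x)"
      using N
    proof eventually_elim
      case (elim x)
      show ?case
      proof (cases "x \<in> S")
        case True
        with sub obtain K where K: "K \<in> \<T>" "x \<in> K" by auto
        have "(\<Sum>L\<in>\<T>. indicator L x *\<^sub>R F x) = (\<Sum>L\<in>\<T>. if L = K then F x else 0)"
          using K elim by (intro sum.cong) (auto simp: indicator_def)
        with K True fin show ?thesis by simp
      next
        case False
        then show ?thesis
          using elim by (auto simp: indicator_def intro!: sum.neutral[symmetric])
      qed
    qed
  qed
  also have "\<dots> = (\<Sum>K\<in>\<T>. \<integral>x. indicator K x *\<^sub>R F x \<partial>lebesgue)"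
    by (rule Bochner_Integration.integral_sum) (rule int)
  also have "\<dots> = (\<Sum>K\<in>\<T>. \<integral>x. F x \<partial>lebesgue_on K)"
    using S(2) by (intro sum.cong refl, subst integral_restrict_space) auto
  finally show ?thesis .
qed

section \<open>Geometry of the domain and of the mesh\<close>

lemma polytopal_domain_open: "polytopal_domain \<Omega> \<Longrightarrow> open \<Omega>"
  by (auto simp: polytopal_domain_def)

text \<open>The interior of a closed set is regular open, and a finite union of polytopes is closed.
  For an arbitrary open set the closure could add a set of positive measure, which the elements
  would then have to cover.\<close>

lemma interior_closure_polytopal_domain:
  assumes "polytopal_domain \<Omega>"
  shows "interior (closure \<Omega>) = \<Omega>"
proof -
  obtain P where P: "finite P" "\<And>p. p \<in> P \<Longrightarrow> polytope p" "\<Omega> = interior (\<Union>P)"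
    using assms by (auto simp: polytopal_domain_def)
  then have "closure \<Omega> \<subseteq> \<Union>P"
    using interior_subset[of "\<Union>P"]
    by (intro closure_minimal closed_Union) (auto intro: polytope_imp_closed)
  then have "interior (closure \<Omega>) \<subseteq> \<Omega>"
    unfolding P(3) by (rule interior_mono)
  moreover have "\<Omega> \<subseteq> interior (closure \<Omega>)"
    by (intro interior_maximal closure_subset polytopal_domain_open assms)
  ultimately show ?thesis by blast
qed

context
  fixes \<Omega> :: "(real^'n) set" and \<T>
  assumes \<Omega>: "polytopal_domain \<Omega>" and mesh: "mesh \<Omega> \<T>"
begin

lemma mesh_element_polytope: "K \<in> \<T> \<Longrightarrow> polytope K"
  using mesh by (auto simp: mesh_def intro: simplex_imp_polytope)

lemma mesh_element_sets: "K \<in> \<T> \<Longrightarrow> K \<in> sets lebesgue"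
  by (intro fmeasurableD lmeasurable_compact polytope_imp_compact mesh_element_polytope)

text \<open>The interior of an element lies in \<open>\<Omega>\<close> by regularity, and the
  boundary of a convex set is null.\<close>

lemma mesh_element_almost_subset:
  assumes K: "K \<in> \<T>"
  shows "negligible (K - \<Omega>)"
proof -
  have "interior K \<subseteq> interior (closure \<Omega>)"
    using K mesh by (intro interior_mono) (auto simp: mesh_def)
  then have "K - \<Omega> \<subseteq> frontier K"
    using closure_subset[of K] by (auto simp: interior_closure_polytopal_domain[OF \<Omega>] frontier_def)
  moreover have "negligible (frontier K)"
    by (intro negligible_convex_frontier polytope_imp_convex mesh_element_polytope K)
  ultimately show ?thesis
    using negligible_subset by blast
qed

text \<open>The intersection is a common face, and as the elements differ it is proper in at least
  one of them. It therefore has smaller dimension, and a convex set with empty interior is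
  null.\<close>

lemma mesh_elements_almost_disjoint:
  assumes K: "K \<in> \<T>" "L \<in> \<T>" "K \<noteq> L"
  shows "negligible (K \<inter> L)"
proof -
  have conv: "convex K" "convex L"
    by (auto intro: polytope_imp_convex mesh_element_polytope K)
  have dim: "aff_dim K = CARD('n)" "aff_dim L = CARD('n)"
    using mesh K by (auto simp: mesh_def aff_dim_simplex)
  have face: "K \<inter> L face_of K" "K \<inter> L face_of L"
    using mesh K unfolding mesh_def triangulation_def by (blast, metis inf_commute)
  have "aff_dim (K \<inter> L) < CARD('n)"
  proof (cases "K \<inter> L = K")
    case True
    with K(3) have "K \<inter> L \<noteq> L" by auto
    with face_of_aff_dim_lt[OF conv(2) face(2)] dim show ?thesis by simp
  next
    case False
    with face_of_aff_dim_lt[OF conv(1) face(1)] dim show ?thesis by simp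
  qed
  then have "interior (K \<inter> L) = {}"
    using aff_dim_nonempty_interior[of "K \<inter> L"] by auto
  then show ?thesis
    using conv by (subst negligible_convex_interior) (auto intro: convex_Int)
qed

lemma L2norm_mesh:
  assumes "g \<in> L2 \<Omega>"
  shows "(L2norm \<Omega> g)\<^sup>2 = (\<Sum>K\<in>\<T>. (L2norm K g)\<^sup>2)"
  unfolding L2norm_square
proof (rule integral_almost_partition)
  show "finite \<T>"
    using mesh by (simp add: mesh_def triangulation_def)
  show "\<Omega> \<subseteq> \<Union>\<T>"
    using mesh closure_subset by (auto simp: mesh_def)
  show "integrable (lebesgue_on \<Omega>) (\<lambda>x. (norm (g x))\<^sup>2)"
    using assms by (simp add: L2_def)
qed (use polytopal_domain_open[OF \<Omega>] in
  \<open>auto intro: mesh_element_sets mesh_element_almost_subset mesh_elements_almost_disjoint\<close>)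

end

section \<open>The error estimator\<close>

text \<open>On H1 fields the operator is, almost everywhere, a finite sum of bounded coefficients
  times square integrable derivatives. This puts the discrete residual into L2, so its norm can be
  summed over the elements.\<close>

lemma nondiv_operator_H1vec_L2:
  assumes S: "\<Omega> \<in> sets lebesgue" and A: "A \<in> Linf \<Omega>" and AG: "nondiv_operator \<Omega> A D AG"
    and \<tau>: "\<tau> \<in> H1vec \<Omega>"
  shows "AG \<tau> \<in> L2 \<Omega>"
proof (rule L2_cong_AE[OF S])
  show "(\<lambda>x. \<Sum>i\<in>UNIV. \<Sum>j\<in>UNIV. A x $ i $ j * weak_grad \<Omega> (\<lambda>y. \<tau> y $ i) x $ j) \<in> L2 \<Omega>"
    using \<tau> by (intro L2_sum L2_Linf_mult Linf_vec_nth A L2_vec_nth weak_grad_L2) (simp add: H1vec_def)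
  show "AE x in lebesgue_on \<Omega>.
      AG \<tau> x = (\<Sum>i\<in>UNIV. \<Sum>j\<in>UNIV. A x $ i $ j * weak_grad \<Omega> (\<lambda>y. \<tau> y $ i) x $ j)"
    using AG \<tau> by (simp add: nondiv_operator_def)
qed

lemma nondiv_operator_diff:
  assumes AG: "nondiv_operator \<Omega> A D AG" and "\<tau> \<in> D" "\<rho> \<in> D"
  shows "AE x in lebesgue_on \<Omega>. AG (\<lambda>x. \<tau> x - \<rho> x) x = AG \<tau> x - AG \<rho> x"
proof -
  have "AE x in lebesgue_on \<Omega>. AG (\<lambda>x. 1 *\<^sub>R \<tau> x + (-1) *\<^sub>R \<rho> x) x = 1 * AG \<tau> x + (-1) * AG \<rho> x"
    using assms unfolding nondiv_operator_def by blast
  then show ?thesis by simp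
qed

text \<open>The solution \<open>v\<close> with right-hand side \<open>f\<close> yields the
  competitor \<open>(v, weak_grad \<Omega> v)\<close>, at which both residuals vanish; hence both
  squares vanish at the minimizer.\<close>

lemma minimizer_solves:
  assumes wp: "well_posed \<Omega> D AG" and f: "f \<in> L2 \<Omega>"
    and min: "is_arg_min (J0 \<Omega> AG f) (\<lambda>p. p \<in> H10 \<Omega> \<times> Qspace \<Omega> D AG) (u, \<sigma>)"
  shows "AE x in lebesgue_on \<Omega>. f x + AG \<sigma> x = 0"
    and "AE x in lebesgue_on \<Omega>. \<sigma> x = weak_grad \<Omega> u x"
proof -
  have u: "u \<in> H1 \<Omega>" and \<sigma>: "\<sigma> \<in> L2 \<Omega>" "AG \<sigma> \<in> L2 \<Omega>"
    using min by (auto simp: is_arg_min_def H10_def Qspace_def)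
  obtain v where v: "v \<in> Vspace \<Omega> D AG" "solves \<Omega> AG f v"
    using wp f unfolding well_posed_def by blast
  then have "v \<in> H1 \<Omega>"
    by (simp add: Vspace_def H10_def)
  then have "(v, weak_grad \<Omega> v) \<in> H10 \<Omega> \<times> Qspace \<Omega> D AG"
    using v weak_grad_L2[of v \<Omega>] by (simp add: Vspace_def Qspace_def)
  then have "J0 \<Omega> AG f (u, \<sigma>) \<le> J0 \<Omega> AG f (v, weak_grad \<Omega> v)"
    using min unfolding is_arg_min_def by (meson not_le_imp_less)
  also have "J0 \<Omega> AG f (v, weak_grad \<Omega> v) = 0"
  proof -
    have "AE x in lebesgue_on \<Omega>. f x + AG (weak_grad \<Omega> v) x = 0"
      using v(2) unfolding solves_def by eventually_elim simp
    then show ?thesis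
      by (simp add: J0_def L2norm_eq_0I)
  qed
  finally have "(L2norm \<Omega> (\<lambda>x. f x + AG \<sigma> x))\<^sup>2 + (L2norm \<Omega> (\<lambda>x. \<sigma> x - weak_grad \<Omega> u x))\<^sup>2 \<le> 0"
    by (simp add: J0_def)
  then have "L2norm \<Omega> (\<lambda>x. f x + AG \<sigma> x) = 0" "L2norm \<Omega> (\<lambda>x. \<sigma> x - weak_grad \<Omega> u x) = 0"
    by (simp_all add: sum_power2_le_zero_iff)
  \<comment> \<open>A function outside L2 can have \<open>L2norm\<close> 0 by the default value of
    the integral, so membership in L2 is established first.\<close>
  then show "AE x in lebesgue_on \<Omega>. f x + AG \<sigma> x = 0" "AE x in lebesgue_on \<Omega>. \<sigma> x = weak_grad \<Omega> u x"
    using L2norm_eq_0D[OF L2_add[OF f \<sigma>(2)]] L2norm_eq_0D[OF L2_diff[OF \<sigma>(1) weak_grad_L2[OF u]]]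
    by auto
qed

text \<open>A general \<open>\<omega>\<close> covers both the single elements and
  \<open>\<Omega>\<close> itself. Each residual is the negative of the corresponding error
  component, so only the pointwise norms are compared.\<close>

lemma estimator_eq_error:
  assumes \<Omega>: "open \<Omega>" and AG: "nondiv_operator \<Omega> A D AG"
    and \<omega>: "\<omega> \<in> sets lebesgue" "negligible (\<omega> - \<Omega>)"
    and u: "u \<in> H1 \<Omega>" "v \<in> H1 \<Omega>" and \<sigma>: "\<sigma> \<in> D" "\<tau> \<in> D"
    and exact: "AE x in lebesgue_on \<Omega>. f x + AG \<sigma> x = 0" "AE x in lebesgue_on \<Omega>. \<sigma> x = weak_grad \<Omega> u x"
  shows "eta_loc \<Omega> AG \<omega> f v \<tau> = triple_norm \<Omega> AG \<omega> (\<lambda>x. u x - v x) (\<lambda>x. \<sigma> x - \<tau> x)"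
proof -
  have S: "\<Omega> \<in> sets lebesgue"
    using \<Omega> by simp
  have "AE x in lebesgue_on \<Omega>. norm (f x + AG \<tau> x) = norm (AG (\<lambda>x. \<sigma> x - \<tau> x) x)"
    using nondiv_operator_diff[OF AG \<sigma>] exact(1) by eventually_elim simp
  moreover have "AE x in lebesgue_on \<Omega>. norm (\<tau> x - weak_grad \<Omega> v x)
      = norm ((\<sigma> x - \<tau> x) - weak_grad \<Omega> (\<lambda>x. u x - v x) x)"
    using weak_grad_diff[OF \<Omega> u] exact(2)
    by eventually_elim (simp add: norm_minus_commute)
  ultimately have "AE x in lebesgue_on \<omega>. norm (f x + AG \<tau> x) = norm (AG (\<lambda>x. \<sigma> x - \<tau> x) x)"
    "AE x in lebesgue_on \<omega>. norm (\<tau> x - weak_grad \<Omega> v x)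
      = norm ((\<sigma> x - \<tau> x) - weak_grad \<Omega> (\<lambda>x. u x - v x) x)"
    by (simp_all add: AE_lebesgue_on_almost_subset[OF S \<omega>])
  note this[THEN L2norm_cong_AE[OF \<omega>(1)]]
  then show ?thesis
    by (simp add: eta_loc_def triple_norm_def)
qed

lemma triple_norm_le:
  assumes "\<tau> \<in> L2 \<omega>" "weak_grad \<Omega> v \<in> L2 \<omega>"
  shows "1 / 2 * triple_norm \<Omega> AG \<omega> v \<tau>
    \<le> L2norm \<omega> (AG \<tau>) + L2norm \<omega> \<tau> + L2norm \<omega> (weak_grad \<Omega> v)" (is "_ \<le> ?a + ?b + ?c")
proof -
  have nn: "0 \<le> ?a" "0 \<le> ?b" "0 \<le> ?c"
    by (auto simp: L2norm_nonneg)
  then have "0 \<le> ?a * ?b" "0 \<le> ?a * ?c" "0 \<le> ?b * ?c"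
    by simp_all
  \<comment> \<open>The left side bounds the squared triple norm. A factor \<surd>2 on the right
    would do; 2 avoids the root and gives the constant 1/2.\<close>
  then have "?a\<^sup>2 + (2 * ?b\<^sup>2 + 2 * ?c\<^sup>2) \<le> (2 * (?a + ?b + ?c))\<^sup>2"
    by (simp add: power2_eq_square algebra_simps)
  with L2norm_diff_square_le[OF assms] have "triple_norm \<Omega> AG \<omega> v \<tau> \<le> 2 * (?a + ?b + ?c)"
    unfolding triple_norm_def using nn by (intro real_le_lsqrt) auto
  then show ?thesis by simp
qed

lemma H1vec_L2: "\<tau> \<in> H1vec \<Omega> \<Longrightarrow> \<tau> \<in> L2 \<Omega>"
  by (rule L2_vecI) (auto simp: H1vec_def H1_def)

theorem theorem3p8:
  fixes \<Omega> :: "(real^'n) set"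
    and A :: "real^'n \<Rightarrow> real^'n^'n"
    and D :: "(real^'n \<Rightarrow> real^'n) set"
    and AG :: "(real^'n \<Rightarrow> real^'n) \<Rightarrow> real^'n \<Rightarrow> real"
    and \<kappa> :: real
  assumes "CARD('n) \<in> {2, 3}"
    and "polytopal_domain \<Omega>"
    and "A \<in> Linf \<Omega>"
    and "nondiv_operator \<Omega> A D AG"
    and "well_posed \<Omega> D AG"
  shows "\<exists>C>0. \<forall>\<T> f u \<sigma> u\<^sub>h \<sigma>\<^sub>h.
           mesh \<Omega> \<T> \<longrightarrow> shape_regular \<kappa> \<T> \<longrightarrow> f \<in> L2 \<Omega> \<longrightarrow>
           is_arg_min (J0 \<Omega> AG f) (\<lambda>p. p \<in> H10 \<Omega> \<times> Qspace \<Omega> D AG) (u, \<sigma>) \<longrightarrow>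
           is_arg_min (J0 \<Omega> AG f) (\<lambda>p. p \<in> S10 \<Omega> \<T> \<times> S1vec \<Omega> \<T>) (u\<^sub>h, \<sigma>\<^sub>h) \<longrightarrow>
             eta_glob \<Omega> AG \<T> f u\<^sub>h \<sigma>\<^sub>h
               = triple_norm \<Omega> AG \<Omega> (\<lambda>x. u x - u\<^sub>h x) (\<lambda>x. \<sigma> x - \<sigma>\<^sub>h x) \<and>
             (\<forall>K\<in>\<T>. eta_loc \<Omega> AG K f u\<^sub>h \<sigma>\<^sub>h
               = triple_norm \<Omega> AG K (\<lambda>x. u x - u\<^sub>h x) (\<lambda>x. \<sigma> x - \<sigma>\<^sub>h x)) \<and>
             (\<forall>K\<in>\<T>. C * eta_loc \<Omega> AG K f u\<^sub>h \<sigma>\<^sub>h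
               \<le> L2norm K (AG (\<lambda>x. \<sigma> x - \<sigma>\<^sub>h x)) + L2norm K (\<lambda>x. \<sigma> x - \<sigma>\<^sub>h x)
                 + L2norm K (weak_grad \<Omega> (\<lambda>x. u x - u\<^sub>h x)))"
proof (rule exI[of _ "1 / 2"], intro conjI allI impI ballI)
  \<comment> \<open>The constant 1/2, taken from \<open>triple_norm_le\<close>, is fixed before the
    mesh, the data and the minimizers, so it depends on none of them.\<close>
  fix \<T> f u \<sigma> u\<^sub>h \<sigma>\<^sub>h
  assume mesh: "mesh \<Omega> \<T>" and f: "f \<in> L2 \<Omega>"
    and min: "is_arg_min (J0 \<Omega> AG f) (\<lambda>p. p \<in> H10 \<Omega> \<times> Qspace \<Omega> D AG) (u, \<sigma>)"
    and min\<^sub>h: "is_arg_min (J0 \<Omega> AG f) (\<lambda>p. p \<in> S10 \<Omega> \<T> \<times> S1vec \<Omega> \<T>) (u\<^sub>h, \<sigma>\<^sub>h)"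
  have \<Omega>: "open \<Omega>" and S: "\<Omega> \<in> sets lebesgue"
    using polytopal_domain_open[OF assms(2)] by auto
  have u: "u \<in> H1 \<Omega>" and \<sigma>: "\<sigma> \<in> D" "\<sigma> \<in> L2 \<Omega>"
    using min by (auto simp: is_arg_min_def H10_def Qspace_def)
  \<comment> \<open>The method is conforming: the discrete functions lie in H1, where weak gradients
    exist and the operator has its explicit form.\<close>
  have u\<^sub>h: "u\<^sub>h \<in> H1 \<Omega>" and \<sigma>\<^sub>h: "\<sigma>\<^sub>h \<in> H1vec \<Omega>"
    using min\<^sub>h by (auto simp: is_arg_min_def S10_def S1_def S1vec_def H1vec_def)
  have \<sigma>\<^sub>h_D: "\<sigma>\<^sub>h \<in> D"
    using assms(4) \<sigma>\<^sub>h by (simp add: nondiv_operator_def)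
  note eq = estimator_eq_error[OF \<Omega> assms(4) _ _ u u\<^sub>h \<sigma>(1) \<sigma>\<^sub>h_D minimizer_solves[OF assms(5) f min]]
  \<comment> \<open>Both discrete residuals lie in L2, so their squared norms over the elements add
    up to those over \<open>\<Omega>\<close>; the global identity is then the case where
    \<open>\<omega>\<close> is \<open>\<Omega>\<close>.\<close>
  have "(eta_loc \<Omega> AG \<Omega> f u\<^sub>h \<sigma>\<^sub>h)\<^sup>2 = (\<Sum>K\<in>\<T>. (eta_loc \<Omega> AG K f u\<^sub>h \<sigma>\<^sub>h)\<^sup>2)"
  proof -
    have "(\<lambda>x. f x + AG \<sigma>\<^sub>h x) \<in> L2 \<Omega>" "(\<lambda>x. \<sigma>\<^sub>h x - weak_grad \<Omega> u\<^sub>h x) \<in> L2 \<Omega>"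
      by (intro L2_add L2_diff f nondiv_operator_H1vec_L2[OF S assms(3,4)] H1vec_L2 weak_grad_L2 u\<^sub>h \<sigma>\<^sub>h)+
    then show ?thesis
      by (simp add: eta_loc_def L2norm_mesh[OF assms(2) mesh] sum.distrib sum_nonneg)
  qed
  then have "eta_glob \<Omega> AG \<T> f u\<^sub>h \<sigma>\<^sub>h = eta_loc \<Omega> AG \<Omega> f u\<^sub>h \<sigma>\<^sub>h"
    by (simp add: eta_glob_def eta_loc_def flip: real_sqrt_unique)
  then show "eta_glob \<Omega> AG \<T> f u\<^sub>h \<sigma>\<^sub>h = triple_norm \<Omega> AG \<Omega> (\<lambda>x. u x - u\<^sub>h x) (\<lambda>x. \<sigma> x - \<sigma>\<^sub>h x)"
    using eq[OF S] by simp
  fix K assume K: "K \<in> \<T>"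
  note sub = mesh_element_sets[OF assms(2) mesh K] mesh_element_almost_subset[OF assms(2) mesh K]
  show eq_K: "eta_loc \<Omega> AG K f u\<^sub>h \<sigma>\<^sub>h = triple_norm \<Omega> AG K (\<lambda>x. u x - u\<^sub>h x) (\<lambda>x. \<sigma> x - \<sigma>\<^sub>h x)"
    by (rule eq[OF sub])
  \<comment> \<open>The chosen gradient of the difference agrees almost everywhere with a difference
    of square integrable gradients, which provides the L2 hypothesis of
    \<open>triple_norm_le\<close>.\<close>
  have "weak_grad \<Omega> (\<lambda>x. u x - u\<^sub>h x) \<in> L2 \<Omega>"
    by (rule L2_cong_AE[OF S L2_diff[OF weak_grad_L2[OF u] weak_grad_L2[OF u\<^sub>h]] weak_grad_diff[OF \<Omega> u u\<^sub>h]])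
  moreover have "(\<lambda>x. \<sigma> x - \<sigma>\<^sub>h x) \<in> L2 \<Omega>"
    by (rule L2_diff[OF \<sigma>(2) H1vec_L2[OF \<sigma>\<^sub>h]])
  ultimately show "1 / 2 * eta_loc \<Omega> AG K f u\<^sub>h \<sigma>\<^sub>h
      \<le> L2norm K (AG (\<lambda>x. \<sigma> x - \<sigma>\<^sub>h x)) + L2norm K (\<lambda>x. \<sigma> x - \<sigma>\<^sub>h x)
        + L2norm K (weak_grad \<Omega> (\<lambda>x. u x - u\<^sub>h x))"
    unfolding eq_K
    by (intro triple_norm_le L2_almost_subset[OF S sub])
qed simp

end
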